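(* Let $G$ be a graph of treewidth $t$ and let $\mathcal H,\mathcal K$ be two non-piercing families of subgraphs of $G$. Then $(G,\mathcal H,\mathcal K)$ admits an intersection support $\tilde Q$ with $\mathrm{tw}(\tilde Q)\le 2^{2^{t+4}+4(t+1)}$.
   Context: All graphs are finite and simple. A subgraph $H$ of a graph $G$ is identified with its vertex set $V(H)$ (subgraphs are taken to be induced), and intersections, differences and containments of subgraphs refer to their vertex sets. A family $\mathcal H$ of subgraphs of $G$ is non-piercing if every $H\in\mathcal H$ induces a connected subgraph of $G$ and, for all $H,H'\in\mathcal H$, the induced subgraph $G[V(H)\setminus V(H')]$ is connected (an empty vertex set is regarded as connected). For families $\mathcal H,\mathcal K$ of subgraphs of $G$ and $K\in\mathcal K$, let $\mathcal H_K=\{H\in\mathcal H: V(H)\cap V(K)\ne\emptyset\}$. An intersection support for $(G,\mathcal H,\mathcal K)$ is a graph $\tilde Q$ with vertex set $\mathcal H$ such that $\tilde Q[\mathcal H_K]$ is connected for every $K\in\mathcal K$. $\mathrm{tw}$ denotes treewidth. *)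

theory Defs
  imports Main
begin

definition graph :: "'v set \<Rightarrow> 'v set set \<Rightarrow> bool" where
  "graph V E \<longleftrightarrow> finite V \<and> (\<forall>e\<in>E. \<exists>u v. u \<noteq> v \<and> u \<in> V \<and> v \<in> V \<and> e = {u, v})"

text \<open>The subgraph induced by S is connected (empty S counts as connected).\<close>
definition connected_set :: "'v set set \<Rightarrow> 'v set \<Rightarrow> bool" where
  "connected_set E S \<longleftrightarrow>
     (\<forall>u\<in>S. \<forall>v\<in>S. (\<lambda>x y. x \<in> S \<and> y \<in> S \<and> {x, y} \<in> E)\<^sup>*\<^sup>* u v)"

definition is_tree :: "'i set \<Rightarrow> 'i set set \<Rightarrow> bool" where
  "is_tree I F \<longleftrightarrow> graph I F \<and> I \<noteq> {} \<and> connected_set F I \<and> card F + 1 = card I"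

definition tree_decomposition ::
  "'v set \<Rightarrow> 'v set set \<Rightarrow> nat set \<Rightarrow> nat set set \<Rightarrow> (nat \<Rightarrow> 'v set) \<Rightarrow> bool" where
  "tree_decomposition V E I F B \<longleftrightarrow>
     is_tree I F \<and>
     (\<forall>i\<in>I. B i \<subseteq> V) \<and>
     (\<forall>v\<in>V. \<exists>i\<in>I. v \<in> B i) \<and>
     (\<forall>e\<in>E. \<exists>i\<in>I. e \<subseteq> B i) \<and>
     (\<forall>v\<in>V. connected_set F {i\<in>I. v \<in> B i})"

text \<open>Treewidth: least k such that there is a tree decomposition with all bags of size \<le> k+1
  (for the empty graph this yields 0 rather than -1).\<close>
definition treewidth :: "'v set \<Rightarrow> 'v set set \<Rightarrow> nat" where
  "treewidth V E = (LEAST k. \<exists>I F B. tree_decomposition V E I F B \<and> (\<forall>i\<in>I. card (B i) \<le> k + 1))"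

text \<open>Non-piercing family of (vertex sets of induced) subgraphs.\<close>
definition non_piercing :: "'v set \<Rightarrow> 'v set set \<Rightarrow> 'v set set \<Rightarrow> bool" where
  "non_piercing V E \<H> \<longleftrightarrow>
     (\<forall>H\<in>\<H>. H \<subseteq> V \<and> connected_set E H) \<and>
     (\<forall>H\<in>\<H>. \<forall>H'\<in>\<H>. connected_set E (H - H'))"

definition intersection_support :: "'v set set \<Rightarrow> 'v set set \<Rightarrow> 'v set set set \<Rightarrow> bool" where
  "intersection_support \<H> \<K> Q \<longleftrightarrow>
     graph \<H> Q \<and> (\<forall>K\<in>\<K>. connected_set Q {H\<in>\<H>. H \<inter> K \<noteq> {}})"

end

theory Submission
  imports Defs
begin

text \<open>Take a tree decomposition of G of width t. If two members of a non-piercing family have the same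
  trace on a bag, then their difference is connected and avoids the bag, so it lies on one side of it.
  This is used twice.

  First the bags are enlarged, by at most two vertices for every trace, until for every K the nodes
  whose bags contain a common vertex of K and some H form a subtree.

  Then the nodes are visited from the root downwards. At each node one representative is kept active
  for every trace of the sets H, and any other H remains active only on the side on which it
  leaves its representative; elsewhere the representative meets every K that H meets. The active sets at
  adjacent nodes, at most one per trace, form the bags of a tree decomposition. The sets that are active
  nowhere are covered by the active sets of a single bag and become leaves. Joining all
  pairs in a common bag gives the support.\<close>

section \<open>Rooted trees and decompositions\<close>

lemma connected_set_sym:
  "(\<lambda>x y. x \<in> S \<and> y \<in> S \<and> {x, y} \<in> E)\<^sup>*\<^sup>* u v \<Longrightarrow> (\<lambda>x y. x \<in> S \<and> y \<in> S \<and> {x, y} \<in> E)\<^sup>*\<^sup>* v u"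
  by (rule sympD[OF symp_rtranclp]) (auto intro!: sympI simp: insert_commute)

text \<open>Numbering parents before children replaces path arguments by induction on numbers. The
  map is total on the naturals and the root is its own parent; a finite tree is an initial segment
  \<open>{..<n}\<close>, which \<open>par\<close> maps into itself.\<close>

locale rooted_tree =
  fixes par :: "nat \<Rightarrow> nat"
  assumes par_0 [simp]: "par 0 = 0"
    and par_less: "0 < k \<Longrightarrow> par k < k"
begin

definition desc :: "nat \<Rightarrow> nat set" where
  "desc k = {j. \<exists>i. (par ^^ i) j = k}"

text \<open>Parents have smaller numbers, so this is connectedness in the tree: only the least node of N
  may have its parent outside N.\<close>
definition subtree :: "nat set \<Rightarrow> bool" where
  "subtree N \<longleftrightarrow> (\<forall>j\<in>N. \<forall>k\<in>N. j < k \<longrightarrow> par k \<in> N)"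

lemma subtreeD: "subtree N \<Longrightarrow> j \<in> N \<Longrightarrow> k \<in> N \<Longrightarrow> j < k \<Longrightarrow> par k \<in> N"
  by (auto simp: subtree_def)

lemma par_le: "par k \<le> k"
  using par_less[of k] by (cases "k = 0") auto

lemma funpow_par_le: "(par ^^ i) j \<le> j"
  by (induction i) (auto intro: order_trans[OF par_le])

lemma desc_ge: "j \<in> desc k \<Longrightarrow> k \<le> j"
  using funpow_par_le by (auto simp: desc_def)

lemma desc_self [simp]: "k \<in> desc k"
  unfolding desc_def by (auto intro: exI[of _ 0])

lemma desc_par: "j \<in> desc k \<Longrightarrow> j \<noteq> k \<Longrightarrow> par j \<in> desc k"
  unfolding desc_def
proof clarify
  fix i assume "j \<noteq> (par ^^ i) j"
  then obtain i' where "i = Suc i'" by (cases i) auto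
  then show "\<exists>i''. (par ^^ i'') (par j) = (par ^^ i) j"
    by (auto simp: funpow_Suc_right simp del: funpow.simps)
qed

lemma par_desc: "par j \<in> desc k \<Longrightarrow> j \<in> desc k"
  unfolding desc_def
  by (auto simp: funpow_Suc_right simp del: funpow.simps intro: exI[of _ "Suc _"])

lemma desc_0 [simp]: "j \<in> desc 0"
proof (induction j rule: less_induct)
  case (less j)
  then show ?case using par_desc par_less by (cases "j = 0") auto
qed

lemma desc_leave: "x \<in> desc k \<Longrightarrow> par x \<notin> desc k \<Longrightarrow> x = k"
  using desc_par by blast

text \<open>The edge between \<open>k\<close> and \<open>par k\<close> is the only way out of
  \<open>desc k\<close>. Replace the larger of \<open>a\<close> and \<open>b\<close> by its parent,
  which stays in \<open>N\<close> because the smaller one is there, until that edge is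
  crossed.\<close>

lemma subtree_crossing:
  assumes N: "subtree N"
  shows "a \<in> N \<Longrightarrow> a \<in> desc k \<Longrightarrow> b \<in> N \<Longrightarrow> b \<notin> desc k \<Longrightarrow> k \<in> N \<and> par k \<in> N"
proof (induction "a + b" arbitrary: a b rule: less_induct)
  case less
  have "a \<noteq> b" using less.prems by auto
  then consider "b < a" | "a < b" by linarith
  then show ?case
  proof cases
    case 1
    have pa: "par a \<in> N" using subtreeD[OF N] 1 less.prems by blast
    show ?thesis
    proof (cases "a = k")
      case True then show ?thesis using pa less.prems by simp
    next
      case False
      show ?thesis
        using less.hyps[of "par a" b] pa 1 less.prems desc_par[OF _ False] par_less[of a] by auto
    qed
  next
    case 2
    have pb: "par b \<in> N" using subtreeD[OF N] 2 less.prems by blast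
    have "par b \<notin> desc k" using par_desc less.prems by blast
    then show ?thesis
      using less.hyps[of a "par b"] pb 2 less.prems par_less[of b] by auto
  qed
qed

lemma subtree_Int: "subtree M \<Longrightarrow> subtree N \<Longrightarrow> subtree (M \<inter> N)"
  by (auto simp: subtree_def)

lemma subtree_Inter: "(\<And>M. M \<in> A \<Longrightarrow> subtree M) \<Longrightarrow> subtree (\<Inter>A)"
  unfolding subtree_def by blast

lemma subtree_desc: "subtree (desc k)"
  unfolding subtree_def by (metis desc_ge desc_par leD)

lemma subtree_not_desc: "subtree (- desc k)"
  unfolding subtree_def using par_desc by blast

lemma subtree_lessThan: "subtree {..<n}"
  unfolding subtree_def using par_le by (auto intro: le_less_trans)

lemma subtree_sing: "subtree {i}"
  by (simp add: subtree_def)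

text \<open>For \<open>j < k\<close> from different sets, \<open>j\<close> lies outside
  \<open>desc k\<close>. Whether or not the common node \<open>c\<close> lies in
  \<open>desc k\<close>, one of the two sets has nodes on both sides of the edge above
  \<open>k\<close> and so contains \<open>par k\<close>.\<close>

lemma subtree_Un:
  assumes M: "subtree M" and N: "subtree N" and c: "c \<in> M" "c \<in> N"
  shows "subtree (M \<union> N)"
proof -
  have *: "par k \<in> M \<union> N"
    if M: "subtree M" and N: "subtree N" and c: "c \<in> M" "c \<in> N"
      and j: "j \<in> M" and k: "k \<in> N" and jk: "j < k" for M N j k
  proof (cases "c \<in> desc k")
    case True
    have "j \<notin> desc k" using desc_ge jk by (meson leD)
    then show ?thesis using subtree_crossing[OF M c(1) True j] by blast
  next
    case False
    then show ?thesis using subtree_crossing[OF N k desc_self c(2)] by blast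
  qed
  show ?thesis
    unfolding subtree_def
    using *[OF M N c] *[OF N M c(2) c(1)] subtreeD[OF M] subtreeD[OF N] by blast
qed

text \<open>This is the node set of the path between \<open>i\<close> and \<open>j\<close>, obtained
  as the least subtree through both ends so that no walks need to be handled.\<close>

definition hull :: "nat \<Rightarrow> nat \<Rightarrow> nat set" where
  "hull i j = \<Inter>{M. subtree M \<and> i \<in> M \<and> j \<in> M}"

lemma subtree_hull: "subtree (hull i j)"
  unfolding hull_def by (rule subtree_Inter) auto

lemma hull_least: "subtree M \<Longrightarrow> i \<in> M \<Longrightarrow> j \<in> M \<Longrightarrow> hull i j \<subseteq> M"
  unfolding hull_def by blast

lemma hull_ends [simp]: "i \<in> hull i j" "j \<in> hull i j"
  unfolding hull_def by auto

lemma hull_commute: "hull i j = hull j i"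
  unfolding hull_def by (rule arg_cong[where f = Inter]) auto

lemma finite_hull: "finite (hull i j)"
  by (rule finite_subset[OF hull_least[OF subtree_lessThan[of "Suc (max i j)"]]]) auto

text \<open>Suppose that \<open>j\<close> is the parent of a remaining node \<open>y\<close> and
  that a smaller node remains. If \<open>i\<close> is in \<open>desc y\<close>, the path lies in
  \<open>desc y\<close> together with \<open>j\<close>, which leaves no room for the smaller node;
  otherwise the path avoids \<open>desc y\<close> and hence \<open>y\<close>.\<close>

lemma subtree_hull_remove_end: "subtree (hull i j - {j})"
proof (cases "i = j")
  case True
  then have "hull i j - {j} = {}" using hull_least[OF subtree_sing[of j]] by auto
  then show ?thesis unfolding subtree_def by blast
next
  case False
  have *: "par y \<noteq> j" if x: "x \<in> hull i j - {j}" and y: "y \<in> hull i j - {j}" and xy: "x < y" for x y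
  proof
    assume j: "par y = j"
    have jy: "j \<notin> desc y" using desc_ge[of j y] par_less[of y] xy j by auto
    show False
    proof (cases "i \<in> desc y")
      case True
      have "subtree (desc y \<union> {j})"
        unfolding subtree_def
      proof (intro ballI impI)
        fix a b assume ab: "a \<in> desc y \<union> {j}" "b \<in> desc y \<union> {j}" "a < b"
        show "par b \<in> desc y \<union> {j}"
        proof (cases "b = j")
          case True
          then have "y < j" using ab desc_ge[of a y] by auto
          then show ?thesis using par_less[of y] xy j by auto
        next
          case False
          then show ?thesis using ab j desc_par by blast
        qed
      qed
      then have "hull i j \<subseteq> desc y \<union> {j}" using True by (intro hull_least) auto
      then show False using x xy desc_ge by (metis DiffE Un_iff leD subsetD)
    next
      case False
      then have "hull i j \<subseteq> - desc y" using jy by (intro hull_least subtree_not_desc) auto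
      then show False using y desc_self by blast
    qed
  qed
  show ?thesis
    unfolding subtree_def
  proof (intro ballI impI)
    fix x y assume xy: "x \<in> hull i j - {j}" "y \<in> hull i j - {j}" "x < y"
    then have "par y \<in> hull i j" using subtreeD[OF subtree_hull[of i j], of x y] by blast
    then show "par y \<in> hull i j - {j}" using *[OF xy] by simp
  qed
qed

text \<open>Among the pairs in \<open>N\<close> whose path leaves \<open>N\<close>, take one with
  the shortest path. A further node of \<open>N\<close> on it would split it into two shorter paths,
  both inside \<open>N\<close> by minimality.\<close>

lemma subtree_gap:
  assumes "\<not> subtree N"
  obtains i j where "i \<in> N" "j \<in> N" "hull i j \<inter> N = {i, j}" "hull i j \<noteq> {i, j}"
proof -
  define P where "P \<equiv> \<lambda>p. fst p \<in> N \<and> snd p \<in> N \<and> \<not> hull (fst p) (snd p) \<subseteq> N"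
  obtain j k where "j \<in> N" "k \<in> N" "j < k" "par k \<notin> N"
    using assms by (auto simp: subtree_def)
  then have "P (j, k)"
    unfolding P_def using subtreeD[OF subtree_hull, of j j k k] by auto
  then obtain p where p: "P p" and least: "\<And>q. P q \<Longrightarrow> card (hull (fst p) (snd p)) \<le> card (hull (fst q) (snd q))"
    using ex_has_least_nat[of P "(j, k)" "\<lambda>p. card (hull (fst p) (snd p))"] by blast
  obtain i j where ij: "p = (i, j)" by force
  have i: "i \<in> N" and j: "j \<in> N" and sub: "\<not> hull i j \<subseteq> N" using p ij by (auto simp: P_def)
  have small: "hull x y \<subseteq> N" if "x \<in> N" "y \<in> N" "hull x y \<subset> hull i j" for x y
    using least[of "(x, y)"] that psubset_card_mono[OF finite_hull that(3)] ij
    by (auto simp: P_def)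
  have "w = i \<or> w = j" if w: "w \<in> hull i j" "w \<in> N" for w
  proof (rule ccontr)
    assume ne: "\<not> (w = i \<or> w = j)"
    have ne': "i \<noteq> j" using ne w hull_least[OF subtree_sing[of j]] by auto
    have 1: "hull i w \<subseteq> hull i j - {j}"
      using ne ne' w by (intro hull_least subtree_hull_remove_end) auto
    have 2: "hull w j \<subseteq> hull i j - {i}"
      using ne ne' w subtree_hull_remove_end[of j i] by (intro hull_least) (auto simp: hull_commute)
    have "hull i w \<subset> hull i j" "hull w j \<subset> hull i j"
      using 1 2 hull_ends[of i j] by auto
    then have "hull i w \<subseteq> N" "hull w j \<subseteq> N"
      using small[OF i w(2)] small[OF w(2) j] by simp_all
    moreover have "hull i j \<subseteq> hull i w \<union> hull w j"
      by (intro hull_least subtree_Un[where c = w] subtree_hull) auto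
    ultimately show False using sub by blast
  qed
  then have "hull i j \<inter> N = {i, j}" using i j by auto
  then show thesis using that[OF i j] sub i j by auto
qed

section \<open>Tree decompositions over a numbered tree\<close>

definition occ :: "nat \<Rightarrow> (nat \<Rightarrow> 'v set) \<Rightarrow> 'v set \<Rightarrow> nat set" where
  "occ n B D = {k. k < n \<and> D \<inter> B k \<noteq> {}}"

definition decomposes :: "nat \<Rightarrow> (nat \<Rightarrow> 'v set) \<Rightarrow> 'v set \<Rightarrow> 'v set set \<Rightarrow> bool" where
  "decomposes n B V E \<longleftrightarrow>
     (\<forall>k<n. B k \<subseteq> V) \<and> (\<forall>v\<in>V. \<exists>k<n. v \<in> B k) \<and> (\<forall>e\<in>E. \<exists>k<n. e \<subseteq> B k) \<and>
     (\<forall>v\<in>V. subtree (occ n B {v}))"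

lemma occ_mono: "C \<subseteq> D \<Longrightarrow> occ n B C \<subseteq> occ n B D"
  by (auto simp: occ_def)

text \<open>Follow a walk in \<open>D\<close> from a vertex of \<open>B j\<close> to a vertex of
  \<open>B k\<close>. A bag containing an edge is common to the occurrences of both its ends, so the
  union of the occurrences along the walk remains a subtree.\<close>

lemma occ_connected:
  assumes dec: "decomposes n B V E" and D: "D \<subseteq> V" "connected_set E D"
  shows "subtree (occ n B D)"
  unfolding subtree_def
proof (intro ballI impI)
  fix j k assume jk: "j \<in> occ n B D" "k \<in> occ n B D" "j < k"
  then obtain u v where u: "u \<in> D" "u \<in> B j" and v: "v \<in> D" "v \<in> B k"
    by (auto simp: occ_def)
  have "(\<lambda>x y. x \<in> D \<and> y \<in> D \<and> {x, y} \<in> E)\<^sup>*\<^sup>* u v"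
    using D u v by (auto simp: connected_set_def)
  then have "\<exists>M. subtree M \<and> M \<subseteq> occ n B D \<and> occ n B {u} \<union> occ n B {v} \<subseteq> M"
  proof induction
    case base
    show ?case
      using dec D u by (intro exI[of _ "occ n B {u}"]) (auto simp: decomposes_def occ_def)
  next
    case (step x y)
    then obtain M where M: "subtree M" "M \<subseteq> occ n B D" "occ n B {u} \<union> occ n B {x} \<subseteq> M" by blast
    obtain q where q: "q < n" "{x, y} \<subseteq> B q" using dec step by (auto simp: decomposes_def)
    have "subtree (M \<union> occ n B {y})"
      using dec step D M q
      by (intro subtree_Un[where c = q]) (auto simp: decomposes_def occ_def)
    moreover have "occ n B {y} \<subseteq> occ n B D" using step by (intro occ_mono) auto
    ultimately show ?case using M by (intro exI[of _ "M \<union> occ n B {y}"]) auto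
  qed
  then obtain M where M: "subtree M" "M \<subseteq> occ n B D" "occ n B {u} \<union> occ n B {v} \<subseteq> M" by blast
  have "j \<in> occ n B {u}" "k \<in> occ n B {v}" using u v jk by (auto simp: occ_def)
  then have "j \<in> M" "k \<in> M" using M(3) by auto
  then show "par k \<in> occ n B D" using subtreeD[OF M(1)] jk M(2) by blast
qed

section \<open>Bridging the gaps\<close>

text \<open>A gap of K is bridged by copying one vertex of K from each of its ends into all bags of the gap.
  By non-piercing, any L in the family with the same trace as K on an original bag inside the gap
  contains one of the two vertices, so every trace pays for at most two new vertices of that bag.
  The sets S k collect the traces that have been paid for.\<close>
lemma bridge_gaps:
  fixes B :: "nat \<Rightarrow> 'v set"
  assumes dec: "decomposes n B V E" and fin: "finite V" and np: "non_piercing V E \<K>"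
  shows "\<lbrakk>\<And>k. k < n \<Longrightarrow> B k \<subseteq> B' k \<and> B' k \<subseteq> V \<and> S k \<subseteq> Pow (B k) \<and> card (B' k) \<le> card (B k) + 2 * card (S k);
      \<And>v. v \<in> V \<Longrightarrow> subtree (occ n B' {v});
      \<And>k K. k < n \<Longrightarrow> K \<in> \<K> \<Longrightarrow> K \<inter> B k \<in> S k \<Longrightarrow> K \<inter> C \<inter> B' k \<noteq> {}\<rbrakk>
    \<Longrightarrow> \<exists>B''. decomposes n B'' V E \<and> (\<forall>k<n. card (B'' k) \<le> card (B k) + 2 * 2 ^ card (B k)) \<and>
           (\<forall>K\<in>\<K>. subtree (occ n B'' (K \<inter> C)))"
\<comment> \<open>The measure counts the traces on original bags that are not yet marked; bridging a
  gap marks at least one more.\<close>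
proof (induction "\<Sum>k<n. card (Pow (B k) - S k)" arbitrary: B' S rule: less_induct)
  case less
  note bags = less.prems(1) and conn = less.prems(2) and marked = less.prems(3)
  have BV: "B k \<subseteq> V" if "k < n" for k using dec that by (auto simp: decomposes_def)
  have finB: "finite (B k)" if "k < n" for k using BV[OF that] fin finite_subset by blast
  show ?case
  proof (cases "\<forall>K\<in>\<K>. subtree (occ n B' (K \<inter> C))")
    case True
    have "card (B' k) \<le> card (B k) + 2 * 2 ^ card (B k)" if k: "k < n" for k
    proof -
      have "card (S k) \<le> card (Pow (B k))"
        using bags[OF k] finB[OF k] by (intro card_mono) auto
      then show ?thesis using bags[OF k] finB[OF k] by (simp add: card_Pow)
    qed
    moreover have "decomposes n B' V E"
      unfolding decomposes_def
    proof (intro conjI ballI allI impI)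
      fix v assume "v \<in> V"
      then show "\<exists>k<n. v \<in> B' k" using dec bags unfolding decomposes_def by (meson subsetD)
    next
      fix e assume "e \<in> E"
      then show "\<exists>k<n. e \<subseteq> B' k" using dec bags unfolding decomposes_def by (meson order_trans)
    qed (use bags conn in auto)
    ultimately show ?thesis using True by blast
  next
    case False
    then obtain K where K: "K \<in> \<K>" "\<not> subtree (occ n B' (K \<inter> C))" by blast
    define N where "N = occ n B' (K \<inter> C)"
    obtain i j where ij: "i \<in> N" "j \<in> N" "hull i j \<inter> N = {i, j}" "hull i j \<noteq> {i, j}"
      using subtree_gap K(2) unfolding N_def by blast
    define I where "I = hull i j - {i, j}"
    have IN: "I \<inter> N = {}" using ij unfolding I_def by blast
    have "hull i j \<subseteq> {..<n}"
      using ij by (intro hull_least subtree_lessThan) (auto simp: N_def occ_def)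
    then have In: "k < n" if "k \<in> I" for k using that by (auto simp: I_def)
    have Ine: "I \<noteq> {}" using ij hull_ends[of i j] hull_ends(2)[of j i] unfolding I_def by blast
    have ne: "i \<noteq> j" using Ine hull_least[OF subtree_sing[of j]] unfolding I_def by auto
    obtain v where v: "v \<in> K" "v \<in> C" "v \<in> B' i" "i < n" using ij by (auto simp: N_def occ_def)
    obtain u where u: "u \<in> K" "u \<in> C" "u \<in> B' j" "j < n" using ij by (auto simp: N_def occ_def)
    have KV: "K \<subseteq> V" using np K by (auto simp: non_piercing_def)
    have vI: "v \<notin> B' k" and uI: "u \<notin> B' k" if "k \<in> I" for k
      using that IN In v u by (auto simp: N_def occ_def)
    define B2 where "B2 = (\<lambda>k. if k \<in> I then B' k \<union> {v, u} else B' k)"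
    define S2 where "S2 = (\<lambda>k. if k \<in> I then insert (K \<inter> B k) (S k) else S k)"
    \<comment> \<open>A marked trace would make \<open>K \<inter> C\<close> meet the enlarged bag,
      which it misses inside the gap.\<close>
    have new: "K \<inter> B k \<notin> S k" if "k \<in> I" for k
      using marked[OF In[OF that] K(1)] that IN In[OF that] by (auto simp: N_def occ_def)
    have finS: "finite (S k)" if "k < n" for k
      using bags[OF that] finB[OF that] by (meson finite_Pow_iff finite_subset)
    have "(\<Sum>k<n. card (Pow (B k) - S2 k)) < (\<Sum>k<n. card (Pow (B k) - S k))"
    proof (rule sum_strict_mono_ex1)
      show "\<forall>k\<in>{..<n}. card (Pow (B k) - S2 k) \<le> card (Pow (B k) - S k)"
        using finB by (auto simp: S2_def intro!: card_mono)
      obtain k where k: "k \<in> I" using Ine by blast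
      have "card (Pow (B k) - S2 k) < card (Pow (B k) - S k)"
        using finB[OF In[OF k]] new[OF k] k by (intro psubset_card_mono) (auto simp: S2_def)
      then show "\<exists>k\<in>{..<n}. card (Pow (B k) - S2 k) < card (Pow (B k) - S k)"
        using In[OF k] by blast
    qed auto
    moreover have "B k \<subseteq> B2 k \<and> B2 k \<subseteq> V \<and> S2 k \<subseteq> Pow (B k) \<and> card (B2 k) \<le> card (B k) + 2 * card (S2 k)"
      if k: "k < n" for k
    proof (cases "k \<in> I")
      case True
      have "card (B2 k) \<le> card (B' k) + card {v, u}"
        unfolding B2_def using True card_Un_le[of "B' k" "{v, u}"] by (simp only: if_True)
      also have "card {v, u} \<le> 2" by (simp add: card_insert_le_m1)
      finally have "card (B2 k) \<le> card (B k) + 2 * card (S2 k)"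
        using bags[OF k] new[OF True] finS[OF k] True by (simp add: S2_def)
      then show ?thesis using True bags[OF k] v u KV by (auto simp: B2_def S2_def)
    qed (use bags[OF k] in \<open>auto simp: B2_def S2_def\<close>)
    moreover have "subtree (occ n B2 {x})" if x: "x \<in> V" for x
    proof (cases "x = v \<or> x = u")
      case False
      then have "occ n B2 {x} = occ n B' {x}" by (auto simp: occ_def B2_def)
      then show ?thesis using conn[OF x] by simp
    next
      case True
      then show ?thesis
      proof
        assume xv: "x = v"
        \<comment> \<open>\<open>v\<close> spreads from its own end \<open>i\<close> and stops
          before \<open>j\<close>, so its occurrences grow by a path attached at \<open>i\<close>.
          The case of \<open>u\<close> is symmetric.\<close>
        have "occ n B2 {x} = occ n B' {x} \<union> (hull i j - {j})"
          using In xv v by (auto simp: occ_def B2_def I_def split: if_splits)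
        moreover have "subtree \<dots>"
          using ne v xv by (intro subtree_Un[where c = i] conn[OF x] subtree_hull_remove_end) (auto simp: occ_def)
        ultimately show ?thesis by simp
      next
        assume xu: "x = u"
        have "occ n B2 {x} = occ n B' {x} \<union> (hull j i - {i})"
          using In xu u by (auto simp: occ_def B2_def I_def hull_commute[of j i] split: if_splits)
        moreover have "subtree \<dots>"
          using ne u xu by (intro subtree_Un[where c = j] conn[OF x] subtree_hull_remove_end) (auto simp: occ_def)
        ultimately show ?thesis by simp
      qed
    qed
    moreover have "L \<inter> C \<inter> B2 k \<noteq> {}" if k: "k < n" and L: "L \<in> \<K>" and tr: "L \<inter> B k \<in> S2 k" for k L
    proof (cases "L \<inter> B k \<in> S k")
      case True
      then show ?thesis using marked[OF k L] by (auto simp: B2_def)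
    next
      case False
      then have kI: "k \<in> I" and eq: "L \<inter> B k = K \<inter> B k" using tr by (auto simp: S2_def split: if_splits)
      \<comment> \<open>Otherwise \<open>K - L\<close> is connected and contains \<open>v\<close>
        and \<open>u\<close>. Its original occurrences, joined to the enlarged occurrences of
        \<open>v\<close> and \<open>u\<close>, contain the whole path from \<open>i\<close> to
        \<open>j\<close>. Neither vertex is in \<open>B' k\<close>, so \<open>K - L\<close> meets
        \<open>B k\<close>, against the equality of the traces.\<close>
      have "v \<in> L \<or> u \<in> L"
      proof (rule ccontr)
        assume "\<not> (v \<in> L \<or> u \<in> L)"
        then have vu: "v \<in> K - L" "u \<in> K - L" using v u by auto
        let ?M = "occ n B (K - L)"
        have "subtree ?M"
          using np K L KV by (intro occ_connected[OF dec]) (auto simp: non_piercing_def)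
        moreover obtain i' where i': "i' < n" "v \<in> B i'" using dec KV v unfolding decomposes_def by (meson subsetD)
        moreover obtain j' where j': "j' < n" "u \<in> B j'" using dec KV u unfolding decomposes_def by (meson subsetD)
        ultimately have "subtree ((?M \<union> occ n B' {v}) \<union> occ n B' {u})"
          using vu KV bags[OF i'(1)] bags[OF j'(1)]
          by (intro subtree_Un[where c = j'] subtree_Un[where c = i'] conn) (auto simp: occ_def)
        then have "hull i j \<subseteq> (?M \<union> occ n B' {v}) \<union> occ n B' {u}"
          using v u by (intro hull_least) (auto simp: occ_def)
        then have "k \<in> ?M" using kI vI[OF kI] uI[OF kI] by (auto simp: I_def occ_def)
        then show False using eq by (auto simp: occ_def)
      qed
      then show ?thesis using kI v u by (auto simp: B2_def)
    qed
    ultimately show ?thesis by (rule less.hyps)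
  qed
qed

corollary exists_connecting_decomposition:
  assumes dec: "decomposes n B V E" and fin: "finite V" and np: "non_piercing V E \<K>"
    and w: "\<And>k. k < n \<Longrightarrow> card (B k) \<le> w"
  obtains B' where "decomposes n B' V E" "\<And>k. k < n \<Longrightarrow> card (B' k) \<le> w + 2 * 2 ^ w"
    "\<And>K. K \<in> \<K> \<Longrightarrow> subtree (occ n B' (K \<inter> C))"
proof -
  obtain B' where B': "decomposes n B' V E" "\<forall>k<n. card (B' k) \<le> card (B k) + 2 * 2 ^ card (B k)"
    "\<forall>K\<in>\<K>. subtree (occ n B' (K \<inter> C))"
    using bridge_gaps[OF dec fin np, of B "\<lambda>_. {}" C] dec by (auto simp: decomposes_def)
  have "card (B' k) \<le> w + 2 * 2 ^ w" if k: "k < n" for k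
  proof -
    have "(2::nat) ^ card (B k) \<le> 2 ^ w" using w[OF k] by (intro power_increasing) auto
    then show ?thesis using B'(2) k w[OF k] by (meson add_mono le_trans mult_le_mono2)
  qed
  then show thesis using that B' by blast
qed

section \<open>Pruning the sets along the tree\<close>

lemma desc_child:
  "q \<in> desc k \<Longrightarrow> q \<noteq> k \<Longrightarrow> \<exists>c. par c = k \<and> k < c \<and> q \<in> desc c"
proof (induction q rule: less_induct)
  case (less q)
  have kq: "k < q" using desc_ge[OF less.prems(1)] less.prems(2) by simp
  show ?case
  proof (cases "par q = k")
    case True
    then show ?thesis using kq desc_self by blast
  next
    case False
    have "par q < q" using kq par_less by simp
    then show ?thesis using less.IH[OF _ desc_par[OF less.prems] False] par_desc by blast
  qed
qed

definition below :: "nat \<Rightarrow> (nat \<Rightarrow> 'v set) \<Rightarrow> nat \<Rightarrow> 'v set" where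
  "below n B x = (\<Union>j\<in>{j. j < n \<and> j \<in> desc x}. B j)"

definition above :: "nat \<Rightarrow> (nat \<Rightarrow> 'v set) \<Rightarrow> nat \<Rightarrow> 'v set" where
  "above n B x = (\<Union>j\<in>{j. j < n \<and> j \<notin> desc x}. B j)"

text \<open>R H is the set of nodes at which H is active; the nodes smaller than m have been processed.
  At a processed node the active sets have different traces. Where H stops being active, some
  active set contains everything that H has beyond that point.\<close>
definition pruned :: "nat \<Rightarrow> (nat \<Rightarrow> 'v set) \<Rightarrow> 'v set set \<Rightarrow> nat \<Rightarrow> ('v set \<Rightarrow> nat set) \<Rightarrow> bool" where
  "pruned n B \<H> m R \<longleftrightarrow>
     (\<forall>H\<in>\<H>. subtree (R H) \<and> R H \<subseteq> occ n B H) \<and>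
     (\<forall>q<m. inj_on (\<lambda>H. H \<inter> B q) {H\<in>\<H>. q \<in> R H}) \<and>
     (\<forall>H\<in>\<H>. \<forall>x<n. par x \<in> R H \<longrightarrow> x \<notin> R H \<longrightarrow> H \<inter> B x \<noteq> {} \<longrightarrow>
        x < m \<and> (\<exists>a\<in>\<H>. x \<in> R a \<and> H \<inter> below n B x \<subseteq> a)) \<and>
     (\<forall>H\<in>\<H>. \<forall>x\<in>R H. par x \<notin> R H \<longrightarrow> H \<inter> B (par x) \<noteq> {} \<longrightarrow>
        par x < m \<and> (\<exists>a\<in>\<H>. par x \<in> R a \<and> H \<inter> above n B x \<subseteq> a)) \<and>
     (\<forall>H\<in>\<H>. R H = {} \<longrightarrow> H = {} \<or> (\<exists>x<m. H \<subseteq> \<Union>{a\<in>\<H>. x \<in> R a \<or> par x \<in> R a}))"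

text \<open>Initially every set is active wherever it meets the bag. Hence no set ceases to be
  active at a neighbouring node that it meets, and only the empty set is active nowhere.\<close>

lemma pruned_occ:
  assumes dec: "decomposes n B V E" and np: "non_piercing V E \<H>"
  shows "pruned n B \<H> 0 (occ n B)"
proof -
  have 1: "H = {}" if "H \<in> \<H>" "occ n B H = {}" for H
  proof -
    have "v \<notin> H" for v
    proof
      assume v: "v \<in> H"
      then have "v \<in> V" using np that by (auto simp: non_piercing_def)
      then obtain k where "k < n" "v \<in> B k" using dec by (auto simp: decomposes_def)
      then have "k \<in> occ n B H" using v by (auto simp: occ_def)
      then show False using that by simp
    qed
    then show ?thesis by blast
  qed
  have 2: "subtree (occ n B H)" if "H \<in> \<H>" for H
    using np that by (intro occ_connected[OF dec]) (auto simp: non_piercing_def)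
  have 3: "par x \<in> occ n B H \<Longrightarrow> x < n \<Longrightarrow> x \<in> occ n B H \<longleftrightarrow> H \<inter> B x \<noteq> {}" for x H
    by (auto simp: occ_def)
  have 4: "x \<in> occ n B H \<Longrightarrow> par x \<in> occ n B H \<longleftrightarrow> H \<inter> B (par x) \<noteq> {}" for x H
    using par_le[of x] by (auto simp: occ_def)
  show ?thesis
    unfolding pruned_def
  proof (intro conjI ballI allI impI)
    fix H assume "H \<in> \<H>"
    then show "subtree (occ n B H)" by (rule 2)
  next
    fix H assume "H \<in> \<H>"
    then show "occ n B H = {} \<Longrightarrow> H = {} \<or> (\<exists>x<0. H \<subseteq> \<Union>{a\<in>\<H>. x \<in> occ n B a \<or> par x \<in> occ n B a})"
      using 1 by blast
  next
    fix H x assume "x < n" "par x \<in> occ n B H" "x \<notin> occ n B H" "H \<inter> B x \<noteq> {}"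
    then have False using 3[of x H] by blast
    then show "x < 0" "\<exists>a\<in>\<H>. x \<in> occ n B a \<and> H \<inter> below n B x \<subseteq> a" by blast+
  next
    fix H x assume "x \<in> occ n B H" "par x \<notin> occ n B H" "H \<inter> B (par x) \<noteq> {}"
    then have False using 4[of x H] by blast
    then show "par x < 0" "\<exists>a\<in>\<H>. par x \<in> occ n B a \<and> H \<inter> above n B x \<subseteq> a" by blast+
  qed simp_all
qed

text \<open>At \<open>k\<close> each trace keeps one representative. The difference between another
  active \<open>H\<close> and its representative is connected and avoids \<open>B k\<close>, so it
  lies in one branch at \<open>k\<close>. If \<open>H\<close> is also active at
  \<open>par k\<close>, it is retained on that side, and the representative has to cover everything
  below \<open>k\<close>; any other \<open>H\<close> is retained in a child branch or
  nowhere.\<close>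

lemma pruned_step:
  assumes dec: "decomposes n B V E" and fin: "finite V" and np: "non_piercing V E \<H>"
    and pr: "pruned n B \<H> k R" and k: "k < n"
  shows "\<exists>R'. pruned n B \<H> (Suc k) R'"
proof -
  have HV: "H \<subseteq> V" if "H \<in> \<H>" for H using np that by (auto simp: non_piercing_def)
  have subH: "subtree (occ n B H)" if "H \<in> \<H>" for H
    using np that by (intro occ_connected[OF dec]) (auto simp: non_piercing_def)
  have subD: "subtree (occ n B (H - G))" if "H \<in> \<H>" "G \<in> \<H>" for H G
    using np that by (intro occ_connected[OF dec]) (auto simp: non_piercing_def)
  have subR: "subtree (R H)" and Rocc: "R H \<subseteq> occ n B H" if "H \<in> \<H>" for H
    using pr[unfolded pruned_def, THEN conjunct1] that by blast+
  have inj: "inj_on (\<lambda>H. H \<inter> B q) {H\<in>\<H>. q \<in> R H}" if "q < k" for q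
    using pr[unfolded pruned_def, THEN conjunct2, THEN conjunct1] that by blast
  have down: "x < k \<and> (\<exists>a\<in>\<H>. x \<in> R a \<and> H \<inter> below n B x \<subseteq> a)"
    if "H \<in> \<H>" "x < n" "par x \<in> R H" "x \<notin> R H" "H \<inter> B x \<noteq> {}" for H x
    by (rule pr[unfolded pruned_def, THEN conjunct2, THEN conjunct2, THEN conjunct1, rule_format, OF that])
  have up: "par x < k \<and> (\<exists>a\<in>\<H>. par x \<in> R a \<and> H \<inter> above n B x \<subseteq> a)"
    if "H \<in> \<H>" "x \<in> R H" "par x \<notin> R H" "H \<inter> B (par x) \<noteq> {}" for H x
    by (rule pr[unfolded pruned_def, THEN conjunct2, THEN conjunct2, THEN conjunct2, THEN conjunct1, rule_format, OF that])
  have empty: "H = {} \<or> (\<exists>x<k. H \<subseteq> \<Union>{a\<in>\<H>. x \<in> R a \<or> par x \<in> R a})"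
    if "H \<in> \<H>" "R H = {}" for H
    by (rule pr[unfolded pruned_def, THEN conjunct2, THEN conjunct2, THEN conjunct2, THEN conjunct2, rule_format, OF that])
  have finbelow: "finite (below n B k)"
    using dec fin unfolding below_def decomposes_def
    by (intro finite_UN_I) (auto intro: finite_subset)

  define A where "A = {H\<in>\<H>. k \<in> R H}"
  \<comment> \<open>The root is its own parent; \<open>0 < k\<close> ensures that there no set
    counts as coming from above.\<close>
  define P where "P = {H\<in>A. 0 < k \<and> par k \<in> R H}"
  \<comment> \<open>Distinct sets active at the processed node \<open>par k\<close> have different
    traces there, so one of the two differences meets \<open>B (par k)\<close>. Being connected and
    disjoint from \<open>B k\<close>, it has nothing below \<open>k\<close>.\<close>
  have nested: "G \<inter> below n B k \<subseteq> G' \<or> G' \<inter> below n B k \<subseteq> G"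
    if G: "G \<in> P" "G' \<in> P" "G \<inter> B k = G' \<inter> B k" for G G'
  proof (cases "G = G'")
    case False
    have dominated: "G \<inter> below n B k \<subseteq> G'"
      if G: "G \<in> P" "G' \<in> P" "G \<inter> B k = G' \<inter> B k" "(G - G') \<inter> B (par k) \<noteq> {}" for G G'
    proof (rule ccontr)
      assume "\<not> ?thesis"
      then obtain q where q: "q \<in> occ n B (G - G')" "q \<in> desc k" by (auto simp: below_def occ_def)
      have "par k \<in> occ n B (G - G')" using G k par_le[of k] by (auto simp: occ_def)
      moreover have "par k \<notin> desc k" using G par_less[of k] desc_ge[of "par k" k] by (auto simp: P_def)
      moreover have "subtree (occ n B (G - G'))" using G by (intro subD) (auto simp: P_def A_def)
      ultimately have "k \<in> occ n B (G - G')" using subtree_crossing q by blast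
      then show False using G by (auto simp: occ_def)
    qed
    have "par k < k" using G par_less by (auto simp: P_def)
    then have "G \<inter> B (par k) \<noteq> G' \<inter> B (par k)"
      using inj_onD[OF inj[of "par k"], of G G'] False G by (auto simp: P_def A_def)
    then have "(G - G') \<inter> B (par k) \<noteq> {} \<or> (G' - G) \<inter> B (par k) \<noteq> {}" by blast
    then show ?thesis using dominated[OF G] dominated[OF G(2) G(1) G(3)[symmetric]] by blast
  qed auto
  \<comment> \<open>A trace occurring in \<open>P\<close> is represented by the set of
    \<open>P\<close> with the largest part below \<open>k\<close>, which by nestedness contains the
    parts of the others. For any other trace an arbitrary active set will do.\<close>
  have "\<exists>a. a \<in> A \<and> a \<inter> B k = S \<and> (\<forall>G\<in>P. G \<inter> B k = S \<longrightarrow> a \<in> P \<and> G \<inter> below n B k \<subseteq> a)"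
    if S: "S \<in> (\<lambda>H. H \<inter> B k) ` A" for S
  proof (cases "\<exists>G\<in>P. G \<inter> B k = S")
    case False
    then show ?thesis using S by blast
  next
    case True
    then obtain G0 where G0: "G0 \<in> P \<and> G0 \<inter> B k = S" by blast
    have "\<forall>G. G \<in> P \<and> G \<inter> B k = S \<longrightarrow> card (G \<inter> below n B k) < Suc (card (below n B k))"
      using finbelow by (auto intro!: card_mono simp: less_Suc_eq_le)
    from ex_has_greatest_nat[OF G0 this]
    obtain a where a: "a \<in> P" "a \<inter> B k = S"
      and max: "\<And>G. G \<in> P \<Longrightarrow> G \<inter> B k = S \<Longrightarrow> card (G \<inter> below n B k) \<le> card (a \<inter> below n B k)"
      by blast
    have "G \<inter> below n B k \<subseteq> a" if G: "G \<in> P" "G \<inter> B k = S" for G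
    proof (rule ccontr)
      assume "\<not> ?thesis"
      then have "a \<inter> below n B k \<subset> G \<inter> below n B k" using nested[OF a(1) G(1)] a G by blast
      then have "card (a \<inter> below n B k) < card (G \<inter> below n B k)"
        using finbelow by (intro psubset_card_mono) auto
      then show False using max[OF G] by simp
    qed
    moreover have "a \<in> A" using a(1) by (simp add: P_def)
    ultimately show ?thesis using a by blast
  qed
  then have "\<forall>S\<in>(\<lambda>H. H \<inter> B k) ` A. \<exists>a. a \<in> A \<and> a \<inter> B k = S \<and>
      (\<forall>G\<in>P. G \<inter> B k = S \<longrightarrow> a \<in> P \<and> G \<inter> below n B k \<subseteq> a)"
    by (rule ballI)
  from bchoice[OF this] obtain r where "\<forall>S\<in>(\<lambda>H. H \<inter> B k) ` A. r S \<in> A \<and> r S \<inter> B k = S \<and>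
      (\<forall>G\<in>P. G \<inter> B k = S \<longrightarrow> r S \<in> P \<and> G \<inter> below n B k \<subseteq> r S)"
    by (rule exE)
  then have r: "r (H \<inter> B k) \<in> A \<and> r (H \<inter> B k) \<inter> B k = H \<inter> B k \<and>
      (\<forall>G\<in>P. G \<inter> B k = H \<inter> B k \<longrightarrow> r (H \<inter> B k) \<in> P \<and> G \<inter> below n B k \<subseteq> r (H \<inter> B k))"
    if "H \<in> A" for H
    by (rule bspec) (rule imageI[OF that])
  define rep where "rep = (\<lambda>H. r (H \<inter> B k))"
  have repA: "rep H \<in> A" and rept: "rep H \<inter> B k = H \<inter> B k" if "H \<in> A" for H
    using r[OF that] by (simp_all add: rep_def)
  have repP: "H \<inter> below n B k \<subseteq> rep H" if "H \<in> P" for H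
    using r[of H] that by (simp add: rep_def P_def)
  have reprep: "rep (rep H) = rep H" if "H \<in> A" for H
    using rept[OF that] by (simp add: rep_def)

  \<comment> \<open>If the difference has a vertex below \<open>k\<close>, it is confined to the
    branch of one child \<open>c\<close>. Then \<open>H\<close> meets \<open>B c\<close>, and it is
    active there because the invariant allows stopping only at processed nodes, whereas
    \<open>k < c\<close>.\<close>
  have direction: "(\<exists>c. par c = k \<and> k < c \<and> c \<in> R H \<and> H \<inter> above n B c \<subseteq> rep H) \<or>
      H \<inter> below n B k \<subseteq> rep H" if H: "H \<in> A" for H
  proof (rule disjCI)
    let ?D = "occ n B (H - rep H)"
    have HH: "H \<in> \<H>" "rep H \<in> \<H>" "k \<in> R H" using H repA[OF H] by (auto simp: A_def)
    assume "\<not> H \<inter> below n B k \<subseteq> rep H"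
    then obtain q where q: "q \<in> ?D" "q \<in> desc k" by (auto simp: below_def occ_def)
    have kD: "k \<notin> ?D" using rept[OF H] by (auto simp: occ_def)
    then have "q \<noteq> k" using q by blast
    then obtain c where c: "par c = k" "k < c" "q \<in> desc c" using desc_child q(2) by blast
    have sub: "?D \<subseteq> desc c"
      using subtree_crossing[OF subD[OF HH(1,2)] q(1) c(3)] kD c(1) by blast
    have "k \<notin> desc c" using desc_ge[of k c] c by auto
    moreover have "k \<in> occ n B H" using Rocc[OF HH(1)] HH by blast
    moreover have "q \<in> occ n B H" using q(1) by (auto simp: occ_def)
    ultimately have "c \<in> occ n B H" using subtree_crossing[OF subH[OF HH(1)]] c(3) by blast
    then have "c \<in> R H" using down[OF HH(1), of c] c HH by (auto simp: occ_def)
    moreover have "H \<inter> above n B c \<subseteq> rep H"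
      using sub by (auto simp: above_def occ_def)
    ultimately show "\<exists>c. par c = k \<and> k < c \<and> c \<in> R H \<and> H \<inter> above n B c \<subseteq> rep H"
      using c by blast
  qed
  define stop where "stop = (\<lambda>H. H \<in> P \<and> rep H \<noteq> H)"
  define go where "go = (\<lambda>H c. H \<in> A - P \<and> rep H \<noteq> H \<and> par c = k \<and> k < c \<and> c \<in> R H \<and> H \<inter> above n B c \<subseteq> rep H)"
  define drop where "drop = (\<lambda>H. H \<in> A - P \<and> rep H \<noteq> H \<and> H \<inter> below n B k \<subseteq> rep H)"
  \<comment> \<open>\<open>go\<close> is tested before dropping because both can apply, for instance
    when \<open>H\<close> is contained in its representative.\<close>
  define R' where "R' = (\<lambda>H. if H \<in> A \<longrightarrow> rep H = H then R H else if stop H then R H - desc k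
      else if \<exists>c. go H c then R H \<inter> desc (SOME c. go H c) else {})"
  have R'_cases: thesis
    if same: "(H \<in> A \<Longrightarrow> rep H = H) \<Longrightarrow> R' H = R H \<Longrightarrow> thesis"
      and stop: "stop H \<Longrightarrow> R' H = R H - desc k \<Longrightarrow> thesis"
      and go: "\<And>c. go H c \<Longrightarrow> R' H = R H \<inter> desc c \<Longrightarrow> thesis"
      and drop: "drop H \<Longrightarrow> R' H = {} \<Longrightarrow> thesis" for H thesis
  proof -
    consider "H \<in> A \<longrightarrow> rep H = H" | "\<not> (H \<in> A \<longrightarrow> rep H = H)" "stop H"
      | "\<not> (H \<in> A \<longrightarrow> rep H = H)" "\<not> stop H" "\<exists>c. go H c"
      | "\<not> (H \<in> A \<longrightarrow> rep H = H)" "\<not> stop H" "\<nexists>c. go H c" by blast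
    then show thesis
    proof cases
      case 1
      then show ?thesis by (intro same) (simp_all add: R'_def)
    next
      case 2
      then show ?thesis by (intro stop) (simp_all add: R'_def)
    next
      case 3
      then have "R' H = R H \<inter> desc (SOME c. go H c)" by (simp add: R'_def)
      with someI_ex[OF 3(3)] show ?thesis by (rule go)
    next
      case 4
      then have "drop H" using direction[of H] unfolding stop_def go_def drop_def by blast
      moreover have "R' H = {}" unfolding R'_def by (simp only: 4 if_False)
      ultimately show ?thesis by (rule drop)
    qed
  qed
  \<comment> \<open>A set in \<open>A - P\<close> has \<open>k\<close> as its least active node, so
    shrinking it changes nothing at the processed nodes.\<close>
  have notP: "R H \<subseteq> {k..}" if H: "H \<in> A - P" for H
    using subtreeD[OF subR, of H _ k] H by (fastforce simp: P_def A_def not_less)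
  have early: "q \<in> R' H \<longleftrightarrow> q \<in> R H" if "q < k" for q H
  proof (rule R'_cases[of H])
    assume "stop H" "R' H = R H - desc k"
    then show ?thesis using that desc_ge[of q k] by auto
  next
    fix c assume "go H c" "R' H = R H \<inter> desc c"
    then show ?thesis using that notP[of H] by (auto simp: go_def)
  next
    assume "drop H" "R' H = {}"
    then show ?thesis using that notP[of H] by (auto simp: drop_def)
  qed auto
  have now: "k \<in> R' H \<longleftrightarrow> k \<in> R H \<and> rep H = H" if "H \<in> \<H>" for H
  proof (rule R'_cases[of H])
    assume "stop H" "R' H = R H - desc k"
    then show ?thesis by (auto simp: stop_def)
  next
    fix c assume "go H c" "R' H = R H \<inter> desc c"
    then show ?thesis using desc_ge[of k c] by (auto simp: go_def)
  next
    assume "drop H" "R' H = {}"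
    then show ?thesis by (auto simp: drop_def)
  qed (use that in \<open>auto simp: A_def\<close>)
  have rep_now: "rep H \<in> \<H>" "k \<in> R' (rep H)" if "H \<in> A" for H
    using repA[OF that] reprep[OF that] now[of "rep H"] by (auto simp: A_def)

  have "subtree (R' H) \<and> R' H \<subseteq> occ n B H" if H: "H \<in> \<H>" for H
  proof (rule R'_cases[of H])
    assume "R' H = R H - desc k"
    then show ?thesis
      using subtree_Int[OF subR[OF H] subtree_not_desc[of k]] Rocc[OF H] by (auto simp: Diff_eq)
  next
    fix c assume "R' H = R H \<inter> desc c"
    then show ?thesis
      using subtree_Int[OF subR[OF H] subtree_desc[of c]] Rocc[OF H] by auto
  qed (use subR[OF H] Rocc[OF H] in \<open>auto simp: subtree_def\<close>)
  moreover have "inj_on (\<lambda>H. H \<inter> B q) {H\<in>\<H>. q \<in> R' H}" if q: "q < Suc k" for q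
  proof (cases "q = k")
    case True
    show ?thesis
      unfolding True
    proof (rule inj_onI)
      fix H G assume "H \<in> {H\<in>\<H>. k \<in> R' H}" "G \<in> {H\<in>\<H>. k \<in> R' H}" "H \<inter> B k = G \<inter> B k"
      then show "H = G" using now[of H] now[of G] by (auto simp: rep_def)
    qed
  next
    case False
    then have qk: "q < k" using q by simp
    then show ?thesis using inj[OF qk] early[OF qk] by simp
  qed
  moreover have "x < Suc k \<and> (\<exists>a\<in>\<H>. x \<in> R' a \<and> H \<inter> below n B x \<subseteq> a)"
    if H: "H \<in> \<H>" "x < n" "par x \<in> R' H" "x \<notin> R' H" "H \<inter> B x \<noteq> {}" for H x
  proof -
    have old: ?thesis if "par x \<in> R H" "x \<notin> R H"
      using down[OF H(1,2) that H(5)] early by (auto intro: less_SucI)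
    show ?thesis
    proof (rule R'_cases[of H])
      assume s: "stop H" "R' H = R H - desc k"
      show ?thesis
      proof (cases "x \<in> R H")
        case True
        \<comment> \<open>Stopping creates a new lower boundary only at \<open>k\<close>, where
          \<open>rep H\<close> covers all of \<open>H\<close> below.\<close>
        then have "x = k" using s H by (auto intro: desc_leave)
        then show ?thesis using s repP[of H] rep_now[of H] by (auto simp: stop_def P_def)
      qed (use old s H in auto)
    next
      fix c assume g: "go H c" "R' H = R H \<inter> desc c"
      then show ?thesis using old H par_desc[of x c] by auto
    qed (use old H in auto)
  qed
  moreover have "par x < Suc k \<and> (\<exists>a\<in>\<H>. par x \<in> R' a \<and> H \<inter> above n B x \<subseteq> a)"
    if H: "H \<in> \<H>" "x \<in> R' H" "par x \<notin> R' H" "H \<inter> B (par x) \<noteq> {}" for H x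
  proof -
    have old: ?thesis if "x \<in> R H" "par x \<notin> R H"
      using up[OF H(1) that H(4)] early by (auto intro: less_SucI)
    show ?thesis
    proof (rule R'_cases[of H])
      assume "stop H" "R' H = R H - desc k"
      then show ?thesis using old H par_desc[of x k] by auto
    next
      fix c assume g: "go H c" "R' H = R H \<inter> desc c"
      show ?thesis
      proof (cases "par x \<in> R H")
        case True
        \<comment> \<open>Restriction to \<open>desc c\<close> creates a new upper boundary only at
          \<open>c\<close>, whose parent is \<open>k\<close>; there \<open>rep H\<close> covers
          \<open>H\<close> outside the branch.\<close>
        then have "x = c" using g H by (auto intro: desc_leave)
        then show ?thesis using g rep_now[of H] by (auto simp: go_def)
      qed (use old g H in auto)
    qed (use old H in auto)
  qed
  moreover have "H = {} \<or> (\<exists>x<Suc k. H \<subseteq> \<Union>{a\<in>\<H>. x \<in> R' a \<or> par x \<in> R' a})"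
    if H: "H \<in> \<H>" "R' H = {}" for H
  proof (rule R'_cases[of H])
    assume "R' H = R H"
    then have "H = {} \<or> (\<exists>x<k. H \<subseteq> \<Union>{a\<in>\<H>. x \<in> R a \<or> par x \<in> R a})" using empty[OF H(1)] H by simp
    moreover have "x < k \<Longrightarrow> (x \<in> R a \<or> par x \<in> R a) = (x \<in> R' a \<or> par x \<in> R' a)" for x a
      using early[of x a] early[of "par x" a] par_le[of x] by simp
    ultimately show ?thesis by (metis (no_types, lifting) Collect_cong less_SucI)
  next
    assume s: "stop H" "R' H = R H - desc k"
    then have "par k \<in> R' H" using desc_ge[of "par k" k] par_less[of k] by (auto simp: stop_def P_def)
    then show ?thesis using H by auto
  next
    fix c assume g: "go H c" "R' H = R H \<inter> desc c"
    then have "c \<in> R' H" by (simp add: go_def)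
    then show ?thesis using H by auto
  next
    assume d: "drop H" "R' H = {}"
    have HA: "H \<in> A" "H \<notin> P" "H \<inter> below n B k \<subseteq> rep H" "k \<in> R H" using d by (auto simp: drop_def A_def)
    \<comment> \<open>The representative covers the part of a dropped set below \<open>k\<close>. A
      vertex elsewhere forces the set to meet \<open>B (par k)\<close>; as it is not active there,
      the invariant supplies a set active at \<open>par k\<close> that covers this side.\<close>
    have "v \<in> \<Union>{a\<in>\<H>. k \<in> R' a \<or> par k \<in> R' a}" if v: "v \<in> H" for v
    proof (cases "v \<in> below n B k")
      case True
      then show ?thesis using HA v rep_now[OF HA(1)] by blast
    next
      case False
      obtain j where j: "j < n" "v \<in> B j" using dec HV[OF H(1)] v unfolding decomposes_def by (meson subsetD)
      have jk: "j \<notin> desc k" using j False by (auto simp: below_def)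
      then have "0 < k" using desc_0 by (cases k) auto
      have "j \<in> occ n B H" "k \<in> occ n B H" using j v Rocc[OF H(1)] HA by (auto simp: occ_def)
      then have "par k \<in> occ n B H" using subtree_crossing[OF subH[OF H(1)]] jk desc_self by blast
      moreover have "par k \<notin> R H" using HA \<open>0 < k\<close> by (auto simp: P_def)
      ultimately obtain a where a: "a \<in> \<H>" "par k \<in> R a" "H \<inter> above n B k \<subseteq> a"
        using up[OF H(1) HA(4)] by (auto simp: occ_def)
      have "v \<in> a" using a(3) v j jk by (auto simp: above_def)
      then show ?thesis using a early[of "par k" a] par_less[OF \<open>0 < k\<close>] by blast
    qed
    then show ?thesis by blast
  qed
  ultimately have "pruned n B \<H> (Suc k) R'" unfolding pruned_def by simp
  then show ?thesis by blast
qed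

lemma exists_pruned:
  assumes "decomposes n B V E" "finite V" "non_piercing V E \<H>"
  shows "m \<le> n \<Longrightarrow> \<exists>R. pruned n B \<H> m R"
proof (induction m)
  case 0
  then show ?case using pruned_occ assms by blast
next
  case (Suc m)
  then show ?case using pruned_step[OF assms] by (meson Suc_le_eq Suc_leD)
qed

section \<open>The support\<close>

definition tree_edges :: "nat \<Rightarrow> nat set set" where
  "tree_edges n = (\<lambda>k. {k, par k}) ` {0<..<n}"

lemma inj_on_parent_edge: "inj_on (\<lambda>k. {k, par k}) {0<..<n}"
proof (rule inj_onI)
  fix x y assume "x \<in> {0<..<n}" "y \<in> {0<..<n}" "{x, par x} = {y, par y}"
  then show "x = y" using par_less[of x] par_less[of y] by (auto simp: doubleton_eq_iff)
qed

lemma subtree_connected_set: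
  assumes S: "subtree S" "S \<subseteq> {..<n}"
  shows "connected_set (tree_edges n) S"
proof -
  let ?r = "\<lambda>x y. x \<in> S \<and> y \<in> S \<and> {x, y} \<in> tree_edges n"
  have "u \<in> S \<Longrightarrow> v \<in> S \<Longrightarrow> u \<le> v \<Longrightarrow> ?r\<^sup>*\<^sup>* u v" for u v
  proof (induction "u + v" arbitrary: u v rule: less_induct)
    case less
    show ?case
    proof (cases "u = v")
      case False
      then have uv: "u < v" using less.prems by simp
      then have p: "par v \<in> S" "par v < v" using subtreeD[OF S(1)] less.prems par_less by auto
      have "?r\<^sup>*\<^sup>* u (par v)"
        using less.hyps[of u "par v"] less.hyps[of "par v" u] p less.prems connected_set_sym
        by (cases "u \<le> par v") auto
      moreover have "?r (par v) v"
        using p less.prems S uv by (auto simp: tree_edges_def insert_commute)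
      ultimately show ?thesis by (rule rtranclp.rtrancl_into_rtrancl)
    qed simp
  qed
  note ordered = this
  have "?r\<^sup>*\<^sup>* u v" if "u \<in> S" "v \<in> S" for u v
  proof (cases "u \<le> v")
    case False
    then have "?r\<^sup>*\<^sup>* v u" using ordered that by simp
    then show ?thesis by (rule connected_set_sym)
  qed (use ordered that in simp)
  then show ?thesis by (simp add: connected_set_def)
qed

lemma is_tree_tree_edges:
  assumes "0 < n"
  shows "is_tree {..<n} (tree_edges n)"
proof -
  have "graph {..<n} (tree_edges n)"
    unfolding graph_def
  proof (intro conjI ballI)
    fix e assume "e \<in> tree_edges n"
    then obtain k where k: "0 < k" "k < n" "e = {k, par k}" by (auto simp: tree_edges_def)
    then show "\<exists>u v. u \<noteq> v \<and> u \<in> {..<n} \<and> v \<in> {..<n} \<and> e = {u, v}"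
      using par_less[of k] by (intro exI[of _ k] exI[of _ "par k"]) auto
  qed simp
  moreover have "card (tree_edges n) + 1 = card {..<n}"
    unfolding tree_edges_def using assms by (simp add: card_image[OF inj_on_parent_edge])
  ultimately show ?thesis
    using assms subtree_connected_set[OF subtree_lessThan[of n]] by (simp add: is_tree_def lessThan_empty_iff)
qed

lemma treewidth_le:
  assumes dec: "decomposes n B V E" and n: "0 < n" and w: "\<And>k. k < n \<Longrightarrow> card (B k) \<le> Suc w"
  shows "treewidth V E \<le> w"
proof -
  have "connected_set (tree_edges n) {k\<in>{..<n}. v \<in> B k}" if "v \<in> V" for v
  proof -
    have "{k\<in>{..<n}. v \<in> B k} = occ n B {v}" by (auto simp: occ_def)
    then show ?thesis
      using dec that by (auto intro!: subtree_connected_set simp: decomposes_def occ_def)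
  qed
  then have "tree_decomposition V E {..<n} (tree_edges n) B"
    using dec is_tree_tree_edges[OF n] unfolding tree_decomposition_def decomposes_def
    by (simp add: Bex_def lessThan_def)
  then show ?thesis
    unfolding treewidth_def by (intro Least_le) (use w in auto)
qed

text \<open>Climb from \<open>p\<close> until the parent lies in \<open>N\<close>; the ancestor
  \<open>j\<close> guarantees that this happens.\<close>

lemma subtree_exit:
  "j \<in> N \<Longrightarrow> p \<in> desc j \<Longrightarrow> p \<notin> N \<Longrightarrow> \<exists>k. par k \<in> N \<and> k \<notin> N \<and> p \<in> desc k \<and> j < k"
proof (induction p rule: less_induct)
  case (less p)
  have ne: "p \<noteq> j" using less.prems by auto
  then have jp: "j < p" using desc_ge[OF less.prems(2)] by simp
  show ?case
  proof (cases "par p \<in> N")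
    case True
    then show ?thesis using less.prems jp desc_self by blast
  next
    case False
    have "par p < p" using jp par_less by simp
    then show ?thesis
      using less.IH[OF _ less.prems(1) desc_par[OF less.prems(2) ne] False] par_desc by blast
  qed
qed

text \<open>Bags are small because sets active at one node have distinct traces. A set meeting
  \<open>K\<close> in \<open>v\<close> is linked, through covering sets that also contain
  \<open>v\<close>, to a set active at a node whose bag contains \<open>v\<close>. The nodes arising
  in this way form the subtree assumed for \<open>K\<close>, along which neighbouring active sets
  are adjacent.\<close>

lemma exists_support:
  fixes \<H> :: "'v set set"
  assumes dec: "decomposes n B V E" and fin: "finite V" and np: "non_piercing V E \<H>" and n: "0 < n"
    and w: "\<And>k. k < n \<Longrightarrow> card (B k) \<le> w"
    and \<K>: "\<And>K. K \<in> \<K> \<Longrightarrow> K \<subseteq> V \<and> subtree (occ n B (K \<inter> \<Union>\<H>))"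
  shows "\<exists>Q. intersection_support \<H> \<K> Q \<and> treewidth \<H> Q \<le> 2 * 2 ^ w"
proof -
  obtain R where pr: "pruned n B \<H> n R" using exists_pruned[OF dec fin np] by blast
  have HV: "H \<subseteq> V" if "H \<in> \<H>" for H using np that by (auto simp: non_piercing_def)
  have finH: "finite \<H>" using HV fin by (meson PowI finite_Pow_iff finite_subset subsetI)
  have subH: "subtree (occ n B H)" if "H \<in> \<H>" for H
    using np that by (intro occ_connected[OF dec]) (auto simp: non_piercing_def)
  have subR: "subtree (R H)" and Rocc: "R H \<subseteq> occ n B H" if "H \<in> \<H>" for H
    using pr[unfolded pruned_def, THEN conjunct1] that by blast+
  have inj: "inj_on (\<lambda>H. H \<inter> B q) {H\<in>\<H>. q \<in> R H}" if "q < n" for q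
    using pr[unfolded pruned_def, THEN conjunct2, THEN conjunct1] that by blast
  have down: "x < n \<and> (\<exists>a\<in>\<H>. x \<in> R a \<and> H \<inter> below n B x \<subseteq> a)"
    if "H \<in> \<H>" "x < n" "par x \<in> R H" "x \<notin> R H" "H \<inter> B x \<noteq> {}" for H x
    by (rule pr[unfolded pruned_def, THEN conjunct2, THEN conjunct2, THEN conjunct1, rule_format, OF that])
  have up: "par x < n \<and> (\<exists>a\<in>\<H>. par x \<in> R a \<and> H \<inter> above n B x \<subseteq> a)"
    if "H \<in> \<H>" "x \<in> R H" "par x \<notin> R H" "H \<inter> B (par x) \<noteq> {}" for H x
    by (rule pr[unfolded pruned_def, THEN conjunct2, THEN conjunct2, THEN conjunct2, THEN conjunct1, rule_format, OF that])
  have empty: "H = {} \<or> (\<exists>x<n. H \<subseteq> \<Union>{a\<in>\<H>. x \<in> R a \<or> par x \<in> R a})"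
    if "H \<in> \<H>" "R H = {}" for H
    by (rule pr[unfolded pruned_def, THEN conjunct2, THEN conjunct2, THEN conjunct2, THEN conjunct2, rule_format, OF that])

  define Y where "Y = (\<lambda>x. {a\<in>\<H>. x \<in> R a \<or> par x \<in> R a})"
  define L where "L = {H\<in>\<H>. R H = {}}"
  have finL: "finite L" using finH by (simp add: L_def)
  obtain e where e: "bij_betw e {0..<card L} L" using ex_bij_betw_nat_finite[OF finL] by blast
  have "\<forall>H\<in>L. \<exists>x. x < n \<and> H \<subseteq> \<Union>(Y x)"
  proof
    fix H assume "H \<in> L"
    then have "H = {} \<or> (\<exists>x<n. H \<subseteq> \<Union>(Y x))" using empty[of H] by (simp add: L_def Y_def)
    \<comment> \<open>An empty set can be attached to any node; \<open>0 < n\<close> provides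
      one.\<close>
    then show "\<exists>x. x < n \<and> H \<subseteq> \<Union>(Y x)" using n by auto
  qed
  from bchoice[OF this] obtain at where at: "\<forall>H\<in>L. at H < n \<and> H \<subseteq> \<Union>(Y (at H))" by (rule exE)
  define m where "m = n + card L"
  \<comment> \<open>The sets active nowhere become nodes from \<open>n\<close> to
    \<open>m - 1\<close>, each hanging from a node whose bag covers it. That node is numbered below
    \<open>n\<close>, so parents still come first.\<close>
  define par' where "par' = (\<lambda>x. if x < n then par x else if x < m then at (e (x - n)) else 0)"
  define Z where "Z = (\<lambda>x. if x < n then Y x else insert (e (x - n)) (Y (at (e (x - n)))))"
  have eL: "e (x - n) \<in> L" if "n \<le> x" "x < m" for x
    using bij_betwE[OF e] that by (auto simp: m_def)
  interpret T: rooted_tree par'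
  proof
    fix k :: nat assume "0 < k"
    then have "k < n \<Longrightarrow> par k < k" using par_less by blast
    moreover have "at (e (k - n)) < k" if "\<not> k < n" "k < m"
      using bspec[OF at eL[of k]] that by simp
    ultimately show "par' k < k" using \<open>0 < k\<close> by (simp add: par'_def)
  next
    show "par' 0 = 0" using n by (simp add: par'_def)
  qed
  have Z_leaf: "\<exists>x<m. H \<in> Z x \<and> Y (at H) \<subseteq> Z x" if "H \<in> L" for H
  proof -
    have "H \<in> e ` {0..<card L}" using e that by (simp add: bij_betw_def)
    then obtain i where i: "i < card L" "e i = H" by auto
    then show ?thesis by (intro exI[of _ "n + i"]) (auto simp: m_def Z_def)
  qed
  have YH: "Y x \<subseteq> \<H>" for x by (auto simp: Y_def)
  have ZH: "Z x \<subseteq> \<H>" if "x < m" for x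
    using that eL[of x] YH by (auto simp: Z_def L_def)
  have YZ: "Y x \<subseteq> Z x" "x < m" if "x < n" for x using that by (simp_all add: Z_def m_def)
  have YL: "Y x \<inter> L = {}" for x by (auto simp: Y_def L_def)
  define Q where "Q = {{H, G} |H G. H \<noteq> G \<and> (\<exists>x<m. H \<in> Z x \<and> G \<in> Z x)}"

  have "T.subtree (T.occ m Z {H})" if H: "H \<in> \<H>" for H
    unfolding T.subtree_def
  proof (intro ballI impI)
    fix j k assume jk: "j \<in> T.occ m Z {H}" "k \<in> T.occ m Z {H}" "j < k"
    then have jm: "j < m" "k < m" and HZ: "H \<in> Z j" "H \<in> Z k" by (auto simp: T.occ_def)
    have HY: "H \<in> Y k \<and> H \<in> Y j" if "k < n" using that HZ jk by (simp add: Z_def)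
    show "par' k \<in> T.occ m Z {H}"
    proof (cases "H \<in> L")
      case True
      \<comment> \<open>A set active nowhere occurs only in the bag of its own leaf.\<close>
      then have "x \<ge> n \<and> e (x - n) = H" if "H \<in> Z x" for x
        using that YL by (auto simp: Z_def split: if_splits)
      then have "j \<ge> n" "k \<ge> n" "e (j - n) = e (k - n)" using HZ by auto
      moreover have "j - n \<in> {0..<card L}" "k - n \<in> {0..<card L}" using calculation jm by (auto simp: m_def)
      ultimately have "j - n = k - n" using e by (auto simp: bij_betw_def dest: inj_onD)
      then show ?thesis using \<open>j \<ge> n\<close> \<open>k \<ge> n\<close> jk by simp
    next
      case False
      show ?thesis
      proof (cases "k < n")
        case True
        have "par k \<in> R H"
        proof (rule ccontr)
          assume "par k \<notin> R H"
          then have "k \<in> R H" using HY[OF True] by (simp add: Y_def)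
          moreover have "j \<in> R H \<or> par j \<in> R H" using HY[OF True] by (simp add: Y_def)
          ultimately have "par k \<in> R H"
            using subtreeD[OF subR[OF H], of _ k] jk par_le[of j] le_less_trans by blast
          then show False using \<open>par k \<notin> R H\<close> by simp
        qed
        then have "H \<in> Y (par k)" using H by (simp add: Y_def)
        then show ?thesis using True par_le[of k] by (auto simp: T.occ_def par'_def Z_def m_def)
      next
        case kn: False
        then have "e (k - n) \<in> L" using eL jm by simp
        then have "H \<in> Y (at (e (k - n)))" "at (e (k - n)) < n"
          using HZ(2) kn False at by (auto simp: Z_def)
        then show ?thesis using kn jm by (auto simp: T.occ_def par'_def Z_def m_def)
      qed
    qed
  qed
  moreover have "\<exists>x<m. H \<in> Z x" if H: "H \<in> \<H>" for H
  proof (cases "R H = {}")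
    case True
    then show ?thesis using Z_leaf[of H] H by (auto simp: L_def)
  next
    case False
    then obtain x where x: "x \<in> R H" by blast
    then have "x < n" using Rocc[OF H] by (auto simp: occ_def)
    then show ?thesis using x H YZ[of x] by (auto simp: Y_def)
  qed
  ultimately have "T.decomposes m Z \<H> Q"
    using ZH unfolding T.decomposes_def Q_def by blast
  \<comment> \<open>There are at most \<open>2 ^ w\<close> active sets at a node and as many at its
    parent. A leaf bag has one further set, absorbed because the width is one less than the bag
    size.\<close>
  moreover have "card (Z x) \<le> Suc (2 * 2 ^ w)" if x: "x < m" for x
  proof -
    have act: "card {a\<in>\<H>. x \<in> R a} \<le> 2 ^ w" if x: "x < n" for x
    proof -
      have finB: "finite (B x)" using dec fin x by (auto simp: decomposes_def intro: finite_subset)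
      then have "card {a\<in>\<H>. x \<in> R a} \<le> card (Pow (B x))"
        by (intro card_inj_on_le[OF inj[OF x]]) auto
      also have "\<dots> \<le> 2 ^ w" using w[OF x] finB by (simp add: card_Pow power_increasing)
      finally show ?thesis .
    qed
    have Y: "card (Y x) \<le> 2 * 2 ^ w" if x: "x < n" for x
    proof -
      have "Y x = {a\<in>\<H>. x \<in> R a} \<union> {a\<in>\<H>. par x \<in> R a}" by (auto simp: Y_def)
      then have "card (Y x) \<le> card {a\<in>\<H>. x \<in> R a} + card {a\<in>\<H>. par x \<in> R a}"
        by (simp add: card_Un_le)
      then show ?thesis using act[OF x] act[of "par x"] par_le[of x] x by simp
    qed
    show ?thesis
    proof (cases "x < n")
      case True
      then show ?thesis using Y[OF True] by (simp add: Z_def)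
    next
      case False
      then have "at (e (x - n)) < n" using eL x at by simp
      then have "card (Y (at (e (x - n)))) \<le> 2 * 2 ^ w" by (rule Y)
      moreover have "card (Z x) \<le> Suc (card (Y (at (e (x - n)))))"
        using False card_insert_le_m1 by (simp add: Z_def card_insert_if finite_subset[OF YH finH])
      ultimately show ?thesis by simp
    qed
  qed
  ultimately have "treewidth \<H> Q \<le> 2 * 2 ^ w"
    using n T.treewidth_le[of m Z \<H> Q "2 * 2 ^ w"] by (simp add: m_def)
  moreover have "graph \<H> Q"
    unfolding graph_def
  proof (intro conjI ballI)
    fix e assume "e \<in> Q"
    then obtain H G x where e: "e = {H, G}" "H \<noteq> G" "x < m" "H \<in> Z x" "G \<in> Z x"
      by (auto simp: Q_def)
    then have "H \<in> \<H>" "G \<in> \<H>" using ZH[of x] by auto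
    then show "\<exists>u v. u \<noteq> v \<and> u \<in> \<H> \<and> v \<in> \<H> \<and> e = {u, v}" using e by blast
  qed (rule finH)
  moreover have "connected_set Q {H\<in>\<H>. H \<inter> K \<noteq> {}}" if K: "K \<in> \<K>" for K
  proof -
    define \<H>K where "\<H>K = {H\<in>\<H>. H \<inter> K \<noteq> {}}"
    define conn where "conn = (\<lambda>X Y. X \<in> \<H>K \<and> Y \<in> \<H>K \<and> {X, Y} \<in> Q)\<^sup>*\<^sup>*"
    have conn_trans: "conn X Z'" if "conn X W" "conn W Z'" for X W Z'
      using that unfolding conn_def by (rule rtranclp_trans)
    have conn_sym: "conn W X" if "conn X W" for X W
      using that unfolding conn_def by (rule connected_set_sym)
    have adj: "conn H G" if "H \<in> \<H>K" "G \<in> \<H>K" "x < m" "H \<in> Z x" "G \<in> Z x" for H G x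
    proof (cases "H = G")
      case False
      then have "{H, G} \<in> Q" using that unfolding Q_def by blast
      then show ?thesis using that unfolding conn_def by (intro r_into_rtranclp) simp
    qed (simp add: conn_def)
    have adjY: "conn H G" if "H \<in> \<H>K" "G \<in> \<H>K" "x < n" "H \<in> Y x" "G \<in> Y x" for H G x
      using adj[OF that(1,2)] YZ[OF that(3)] that by blast
    have Rn: "x < n" if "H \<in> \<H>" "x \<in> R H" for H x using Rocc[OF that(1)] that by (auto simp: occ_def)
    have hit: "H \<in> \<H>K" if "H \<in> \<H>" "v \<in> H" "v \<in> K" for H v using that by (auto simp: \<H>K_def)
    \<comment> \<open>On the way down to \<open>p\<close>, where \<open>H\<close> stops being
      active, it is replaced by the covering set. That set still contains \<open>v\<close> and
      shares a bag \<open>Y x\<close> with \<open>H\<close>, and it is active closer to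
      \<open>p\<close>.\<close>
    have desc_reach: "\<exists>a\<in>\<H>K. p \<in> R a \<and> conn H a"
      if "H \<in> \<H>" "j \<in> R H" "p \<in> desc j" "v \<in> H" "v \<in> K" "v \<in> B p" "p < n" for H j p v
      using that
    proof (induction "p - j" arbitrary: H j rule: less_induct)
      case less
      show ?case
      proof (cases "p \<in> R H")
        case True
        then show ?thesis using hit[of H v] less.prems by (auto simp: conn_def)
      next
        case False
        then obtain x where x: "par x \<in> R H" "x \<notin> R H" "p \<in> desc x" "j < x"
          using subtree_exit less.prems by blast
        have "p \<in> occ n B H" "j \<in> occ n B H"
          using less.prems Rocc[of H] by (auto simp: occ_def)
        moreover have "j \<notin> desc x" using desc_ge[of j x] x by auto
        ultimately have "x \<in> occ n B H" using subtree_crossing[OF subH] less.prems(1) x(3) by blast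
        then have xn: "x < n" "H \<inter> B x \<noteq> {}" by (auto simp: occ_def)
        then obtain a where a: "a \<in> \<H>" "x \<in> R a" "H \<inter> below n B x \<subseteq> a"
          using down[OF less.prems(1) _ x(1,2)] by blast
        have va: "v \<in> a" using a(3) less.prems x by (auto simp: below_def)
        have "p - x < p - j" using x desc_ge[OF x(3)] by simp
        then obtain b where b: "b \<in> \<H>K" "p \<in> R b" "conn a b"
          using less.hyps[of x a] a va x less.prems by blast
        have "conn H a"
          using adjY[OF hit hit xn(1)] less.prems a va x by (auto simp: Y_def)
        then show ?thesis using b conn_trans by blast
      qed
    qed
    \<comment> \<open>If \<open>p\<close> is not below \<open>j\<close>, the climb goes to
      \<open>par j\<close>, with a change to the covering set if \<open>H\<close> is inactive there.
      Once \<open>p\<close> is below, the descent takes over.\<close>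
    have reach': "\<exists>a\<in>\<H>K. p \<in> R a \<and> conn H a"
      if "H \<in> \<H>" "j \<in> R H" "v \<in> H" "v \<in> K" "v \<in> B p" "p < n" for H j p v
      using that
    proof (induction j arbitrary: H rule: less_induct)
      case (less j)
      show ?case
      proof (cases "p \<in> desc j")
        case True
        then show ?thesis using desc_reach less.prems by blast
      next
        case False
        then have "0 < j" using desc_0 by (cases j) auto
        then have pj: "par j < j" by (rule par_less)
        show ?thesis
        proof (cases "par j \<in> R H")
          case True
          then show ?thesis using less.IH[OF pj] less.prems by blast
        next
          case par: False
          have "p \<in> occ n B H" "j \<in> occ n B H"
            using less.prems Rocc[of H] by (auto simp: occ_def)
          then have "par j \<in> occ n B H"
            using subtree_crossing[OF subH] less.prems(1) False desc_self by blast
          then obtain a where a: "a \<in> \<H>" "par j \<in> R a" "H \<inter> above n B j \<subseteq> a"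
            using up[OF less.prems(1,2) par] by (auto simp: occ_def)
          have va: "v \<in> a" using a(3) less.prems False by (auto simp: above_def)
          obtain b where b: "b \<in> \<H>K" "p \<in> R b" "conn a b"
            using less.IH[OF pj a(1,2) va] less.prems by blast
          have "conn H a"
            using adjY[OF hit hit Rn[OF less.prems(1,2)]] less.prems a va by (auto simp: Y_def)
          then show ?thesis using b conn_trans by blast
        qed
      qed
    qed
    \<comment> \<open>A set active nowhere is first exchanged for a set containing \<open>v\<close>
      in the bag at which its leaf hangs.\<close>
    have reach: "\<exists>a\<in>\<H>K. p \<in> R a \<and> conn H a"
      if H: "H \<in> \<H>" "v \<in> H" "v \<in> K" "v \<in> B p" "p < n" for H p v
    proof (cases "R H = {}")
      case False
      then show ?thesis using reach' H by blast
    next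
      case True
      then have HL: "H \<in> L" using H by (simp add: L_def)
      then obtain a where a: "a \<in> Y (at H)" "v \<in> a" using at H by blast
      obtain x where x: "x < m" "H \<in> Z x" "Y (at H) \<subseteq> Z x" using Z_leaf[OF HL] by blast
      have aH: "a \<in> \<H>" using a YH by blast
      have "conn H a" using adj[OF hit hit x(1,2)] a x H aH by blast
      moreover obtain j where "j \<in> R a" using a by (auto simp: Y_def)
      then obtain b where "b \<in> \<H>K" "p \<in> R b" "conn a b" using reach'[OF aH _ a(2)] H by blast
      ultimately show ?thesis using conn_trans by blast
    qed
    define N where "N = occ n B (K \<inter> \<Union>\<H>)"
    have subN: "subtree N" using \<K>[OF K] by (simp add: N_def)
    have active: "\<exists>a\<in>\<H>K. p \<in> R a" if "p \<in> N" for p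
      using that reach by (fastforce simp: N_def occ_def)
    \<comment> \<open>\<open>s\<close> is the top of the subtree \<open>N\<close>. Climbing through
      \<open>N\<close> links every active set met by \<open>K\<close> to each one at
      \<open>s\<close>, so all of them are linked to each other.\<close>
    define s where "s = (LEAST p. p \<in> N)"
    have to_top: "conn a c"
      if "p \<in> N" "a \<in> \<H>K" "p \<in> R a" "c \<in> \<H>K" "s \<in> R c" for p a c
      using that(1-3)
    proof (induction p arbitrary: a rule: less_induct)
      case (less p)
      have pn: "p < n" using less.prems by (simp add: N_def occ_def)
      have sp: "s \<le> p" "s \<in> N" using less.prems(1) unfolding s_def by (auto intro: Least_le LeastI)
      show ?case
      proof (cases "s = p")
        case True
        then show ?thesis
          using adjY[OF less.prems(2) that(4) pn] less.prems that by (auto simp: Y_def \<H>K_def)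
      next
        case False
        then have p': "par p \<in> N" "par p < p" using subtreeD[OF subN sp(2) less.prems(1)] sp par_less by auto
        then obtain b where b: "b \<in> \<H>K" "par p \<in> R b" using active by blast
        have "conn a b"
          using adjY[OF less.prems(2) b(1) pn] less.prems b by (auto simp: Y_def \<H>K_def)
        then show ?thesis using less.IH[OF p'(2,1) b] conn_trans by blast
      qed
    qed
    have start: "\<exists>p\<in>N. \<exists>a\<in>\<H>K. p \<in> R a \<and> conn H a" if "H \<in> \<H>K" for H
    proof -
      obtain v where v: "v \<in> H" "v \<in> K" "H \<in> \<H>" using \<open>H \<in> \<H>K\<close> by (auto simp: \<H>K_def)
      then have "v \<in> V" using HV by blast
      then obtain p where p: "p < n" "v \<in> B p" using dec by (auto simp: decomposes_def)
      then have "p \<in> N" using v by (auto simp: N_def occ_def)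
      then show ?thesis using reach[OF v(3,1,2) p(2,1)] by blast
    qed
    have "conn H G" if HG: "H \<in> \<H>K" "G \<in> \<H>K" for H G
    proof -
      obtain p a where p: "p \<in> N" "a \<in> \<H>K" "p \<in> R a" "conn H a" using start[OF HG(1)] by blast
      obtain q b where q: "q \<in> N" "b \<in> \<H>K" "q \<in> R b" "conn G b" using start[OF HG(2)] by blast
      have "s \<in> N" using p(1) unfolding s_def by (rule LeastI)
      then obtain c where c: "c \<in> \<H>K" "s \<in> R c" using active by blast
      show ?thesis
        using conn_trans[OF p(4) to_top[OF p(1-3) c]] conn_trans[OF q(4) to_top[OF q(1-3) c]]
          conn_trans conn_sym by blast
    qed
    then show ?thesis by (simp add: connected_set_def \<H>K_def conn_def)
  qed
  ultimately show ?thesis unfolding intersection_support_def by blast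
qed

end

section \<open>Numbering an arbitrary tree decomposition\<close>

lemma tree_enumeration:
  assumes tree: "is_tree I F"
  obtains f par where "rooted_tree par" "bij_betw f {..<card I} I"
    "\<And>e. e \<in> F \<Longrightarrow> \<exists>k. 0 < k \<and> k < card I \<and> e = {f k, f (par k)}"
proof -
  have fin: "finite I" and con: "connected_set F I" and card: "card F + 1 = card I" and ne: "I \<noteq> {}"
    and FI: "F \<subseteq> Pow I"
    using tree by (auto simp: is_tree_def graph_def)
  let ?P = "\<lambda>m f par. rooted_tree par \<and> inj_on f {..<m} \<and> f ` {..<m} \<subseteq> I \<and>
      (\<forall>k. 0 < k \<and> k < m \<longrightarrow> {f k, f (par k)} \<in> F)"
  \<comment> \<open>The enumeration grows one node at a time: a walk from \<open>f 0\<close> to a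
    missing node leaves the enumerated part along an edge, whose outer end gets the next
    number.\<close>
  have "m \<le> card I \<Longrightarrow> \<exists>f par. ?P m f par" if "1 \<le> m" for m
    using that
  proof (induction m rule: nat_induct_at_least)
    case base
    obtain x where "x \<in> I" using ne by blast
    then have "?P 1 (\<lambda>_. x) (\<lambda>_. 0)" by (auto simp: rooted_tree_def lessThan_Suc)
    then show ?case by blast
  next
    case (Suc m)
    then obtain f par where IH: "?P m f par" by auto
    define A where "A = f ` {..<m}"
    have "card A < card I" using IH Suc by (simp add: A_def card_image)
    then obtain y where y: "y \<in> I" "y \<notin> A" by (metis IH A_def subsetI subset_antisym less_irrefl)
    have f0: "f 0 \<in> A" using Suc by (auto simp: A_def)
    have "(\<lambda>x y. x \<in> I \<and> y \<in> I \<and> {x, y} \<in> F)\<^sup>*\<^sup>* (f 0) y"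
      using con y f0 IH unfolding connected_set_def A_def by blast
    then have "y \<in> A \<or> (\<exists>u v. u \<in> A \<and> v \<in> I \<and> v \<notin> A \<and> {u, v} \<in> F)"
      by induction (use f0 in auto)
    then obtain u v where uv: "u \<in> A" "v \<in> I" "v \<notin> A" "{u, v} \<in> F" using y by blast
    obtain l where l: "l < m" "u = f l" using uv by (auto simp: A_def)
    define g where "g = f(m := v)"
    define par' where "par' = par(m := l)"
    interpret rooted_tree par using IH by simp
    have "rooted_tree par'"
      using l par_less by unfold_locales (auto simp: par'_def)
    moreover have "inj_on g {..<Suc m}"
      using IH uv by (auto simp: g_def A_def lessThan_Suc inj_on_def)
    moreover have "g ` {..<Suc m} \<subseteq> I" using IH uv by (auto simp: g_def lessThan_Suc)
    moreover have "{g k, g (par' k)} \<in> F" if k: "0 < k" "k < Suc m" for k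
    proof (cases "k = m")
      case True
      then show ?thesis using uv l by (simp add: g_def par'_def insert_commute)
    next
      case False
      then have "k < m" "par k < m" using k par_less[of k] by auto
      then show ?thesis using IH k by (simp add: g_def par'_def)
    qed
    ultimately show ?case by blast
  qed
  moreover have "1 \<le> card I" using card by simp
  ultimately obtain f par where P: "?P (card I) f par" by blast
  interpret rooted_tree par using P by simp
  have bij: "bij_betw f {..<card I} I"
    unfolding bij_betw_def using P fin card_subset_eq[of I "f ` {..<card I}"] by (simp add: card_image)
  \<comment> \<open>The parent edges are distinct, so there are \<open>card I - 1\<close> of them. A
    tree has no more edges, hence they exhaust \<open>F\<close>.\<close>
  let ?G = "(\<lambda>k. {f k, f (par k)}) ` {0<..<card I}"
  have "inj_on (\<lambda>k. f ` {k, par k}) {0<..<card I}"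
  proof (rule inj_onI)
    fix x y assume x: "x \<in> {0<..<card I}" and y: "y \<in> {0<..<card I}" and eq: "f ` {x, par x} = f ` {y, par y}"
    have "{x, par x} = {y, par y}"
    proof (rule inj_on_image_eq_iff[THEN iffD1, OF _ _ _ eq])
      show "inj_on f {..<card I}" using P by simp
    qed (use x y par_less[of x] par_less[of y] in auto)
    then show "x = y" using inj_onD[OF inj_on_parent_edge _ x y] by simp
  qed
  then have "card ?G = card I - 1" by (simp add: card_image)
  moreover have "?G \<subseteq> F" using P by auto
  moreover have "finite F" using FI fin by (simp add: finite_subset)
  ultimately have "?G = F" using card by (intro card_subset_eq) auto
  then have "\<exists>k. 0 < k \<and> k < card I \<and> e = {f k, f (par k)}" if "e \<in> F" for e
    using that by auto
  then show thesis using that[of par f] P bij by blast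
qed

lemma treewidth_decomposition:
  assumes G: "graph V E" and t: "treewidth V E = t"
  obtains I F B where "tree_decomposition V E I F B" "\<And>i. i \<in> I \<Longrightarrow> card (B i) \<le> t + 1"
proof -
  let ?P = "\<lambda>k. \<exists>I F B. tree_decomposition V E I F B \<and> (\<forall>i\<in>I. card (B i) \<le> k + 1)"
  \<comment> \<open>The single bag \<open>V\<close> shows that some width is attained, hence so is
    the least one.\<close>
  have "tree_decomposition V E {0} {} (\<lambda>_. V)"
    using G by (auto simp: tree_decomposition_def is_tree_def graph_def connected_set_def)
  then have "?P (card V)" by (intro exI[of _ "{0}"] exI[of _ "{}"] exI[of _ "\<lambda>_. V"]) simp
  then have "?P t" using LeastI[of ?P "card V"] t unfolding treewidth_def by simp
  then show thesis using that by blast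
qed

lemma rooted_decomposition:
  assumes td: "tree_decomposition V E I F B"
  obtains par f where "rooted_tree par" "bij_betw f {..<card I} I"
    "rooted_tree.decomposes par (card I) (B \<circ> f) V E"
proof -
  have tree: "is_tree I F" using td by (simp add: tree_decomposition_def)
  obtain f par where par: "rooted_tree par" and f: "bij_betw f {..<card I} I"
    and F: "\<And>e. e \<in> F \<Longrightarrow> \<exists>k. 0 < k \<and> k < card I \<and> e = {f k, f (par k)}"
    using tree_enumeration[OF tree] by blast
  interpret rooted_tree par by (rule par)
  have fI: "f ` {..<card I} = I" and inj: "inj_on f {..<card I}" using f by (auto simp: bij_betw_def)
  have ex: "(\<exists>i\<in>I. P i) \<longleftrightarrow> (\<exists>k<card I. P (f k))" for P using fI by (metis imageE imageI lessThan_iff)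
  have "subtree (occ (card I) (B \<circ> f) {v})" if v: "v \<in> V" for v
    unfolding subtree_def
  proof (intro ballI impI, rule ccontr)
    let ?N = "occ (card I) (B \<circ> f) {v}" and ?S = "{i\<in>I. v \<in> B i}"
    fix j k assume jk: "j \<in> ?N" "k \<in> ?N" "j < k" and no: "par k \<notin> ?N"
    have N: "x \<in> ?N \<longleftrightarrow> x < card I \<and> f x \<in> ?S" for x using fI by (auto simp: occ_def)
    have "connected_set F ?S" using td v by (simp add: tree_decomposition_def)
    moreover have "f k \<in> ?S" "f j \<in> ?S" using jk N by auto
    ultimately have "(\<lambda>x y. x \<in> ?S \<and> y \<in> ?S \<and> {x, y} \<in> F)\<^sup>*\<^sup>* (f k) (f j)"
      unfolding connected_set_def by (elim ballE) auto
    \<comment> \<open>A walk inside the occurrences of v can leave the descendants of k only through its parent.\<close>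
    then have "\<exists>x. x < card I \<and> x \<in> desc k \<and> f x = f j"
    proof induction
      case base
      then show ?case using jk N by auto
    next
      case (step y z)
      then obtain x where x: "x < card I" "x \<in> desc k" "f x = y" by blast
      obtain c where c: "0 < c" "c < card I" "{y, z} = {f c, f (par c)}" using F step by blast
      have pc: "par c < card I" using c par_less[of c] by simp
      from c(3) consider "y = f c" "z = f (par c)" | "y = f (par c)" "z = f c"
        by (auto simp: doubleton_eq_iff)
      then show ?case
      proof cases
        case 1
        then have "x = c" using inj x c by (auto dest: inj_onD)
        moreover have "c \<noteq> k" using no 1 step N pc by auto
        ultimately show ?thesis using desc_par x pc 1 by blast
      next
        case 2
        then have "x = par c" using inj x pc by (auto dest: inj_onD)
        then show ?thesis using par_desc x c 2 by blast
      qed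
    qed
    then obtain x where "x < card I" "x \<in> desc k" "f x = f j" by blast
    moreover have "j < card I" using jk by (simp add: N)
    ultimately have "j \<in> desc k" using inj by (auto dest: inj_onD)
    then show False using desc_ge jk(3) by (meson leD)
  qed
  then have "decomposes (card I) (B \<circ> f) V E"
    using td fI unfolding decomposes_def tree_decomposition_def ex by auto
  then show thesis using that par f by blast
qed

theorem mainTheorem3:
  fixes V :: "'a set" and E :: "'a set set" and \<H> \<K> :: "'a set set" and t :: nat
  assumes "graph V E"
    and "treewidth V E = t"
    and "non_piercing V E \<H>"
    and "non_piercing V E \<K>"
  shows "\<exists>Q. intersection_support \<H> \<K> Q \<and>
               treewidth \<H> Q \<le> 2 ^ (2 ^ (t + 4) + 4 * (t + 1))"
proof -
  have fin: "finite V" using assms(1) by (simp add: graph_def)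
  obtain I F B where td: "tree_decomposition V E I F B" and t: "\<And>i. i \<in> I \<Longrightarrow> card (B i) \<le> t + 1"
    using treewidth_decomposition[OF assms(1,2)] by blast
  obtain par f where par: "rooted_tree par" and f: "bij_betw f {..<card I} I"
    and dec: "rooted_tree.decomposes par (card I) (B \<circ> f) V E"
    using rooted_decomposition[OF td] by blast
  interpret rooted_tree par by (rule par)
  have "card ((B \<circ> f) k) \<le> t + 1" if "k < card I" for k
    using t bij_betwE[OF f] that by auto
  \<comment> \<open>Here \<open>C\<close> is the union of \<open>\<H>\<close>. Non-piercing of
    \<open>\<K>\<close> serves the bridging, that of \<open>\<H>\<close> the pruning.\<close>
  from exists_connecting_decomposition[OF dec fin assms(4) this]
  obtain B' where B': "decomposes (card I) B' V E"
    and w: "\<And>k. k < card I \<Longrightarrow> card (B' k) \<le> (t + 1) + 2 * 2 ^ (t + 1)"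
    and conn: "\<And>K. K \<in> \<K> \<Longrightarrow> subtree (occ (card I) B' (K \<inter> \<Union>\<H>))"
    by blast
  have "0 < card I" using td by (auto simp: tree_decomposition_def is_tree_def)
  then obtain Q where Q: "intersection_support \<H> \<K> Q" "treewidth \<H> Q \<le> 2 * 2 ^ ((t + 1) + 2 * 2 ^ (t + 1))"
    using exists_support[OF B' fin assms(3) _ w] conn assms(4) by (metis non_piercing_def)
  \<comment> \<open>The exponent is \<open>t + 2 + 2 ^ (t + 2)\<close>, well within the claimed
    one.\<close>
  have "(2::nat) * 2 ^ ((t + 1) + 2 * 2 ^ (t + 1)) = 2 ^ Suc ((t + 1) + 2 * 2 ^ (t + 1))"
    by simp
  also have "\<dots> \<le> 2 ^ (2 ^ (t + 4) + 4 * (t + 1))"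
    by (rule power_increasing) (simp_all add: power_add)
  finally show ?thesis using Q by (meson order_trans)
qed

end
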